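(* Let $f=\delta_0-\delta_1:\mathbb{Z}_3\to\mathbb{C}$ (that is, $N=3$, $d=1$), so that $E=\mathrm{supp}(f)=\{0,1\}$ and $\Sigma=\mathrm{supp}(\hat f)=\{1,2\}$. Then for every integer $k\ge 2$, $$|E|\cdot\|1_\Sigma\|_{U^k}^{2^k/(k+1)}=\frac{2}{3}\bigl(2(k+1)\bigr)^{1/(k+1)}.$$ This quantity is strictly less than $1$ if and only if $k\ge 6$, and it decreases to $2/3$ as $k\to\infty$. In particular, for every $k\ge 6$ the assertion "for all $N\ge 2$, $d\ge 1$ and every nonzero $g:\mathbb{Z}_N^d\to\mathbb{C}$, one has $1\le |\mathrm{supp}(g)|\cdot\|1_{\mathrm{supp}(\hat g)}\|_{U^k}^{2^k/(k+1)}$" is false.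
   Context: $\mathbb{Z}_N=\mathbb{Z}/N\mathbb{Z}$; $\delta_a$ is the indicator function of the point $a$; $1_S$ is the indicator function of the set $S$; $\mathrm{supp}$ is the set where a function is nonzero. For $f:\mathbb{Z}_N^d\to\mathbb{C}$ the discrete Fourier transform is $\hat f(m)=N^{-d/2}\sum_{x\in\mathbb{Z}_N^d}f(x)\chi(-m\cdot x)$ with $\chi(t)=e^{2\pi i t/N}$. For $k\ge 2$, the Gowers norm $\|f\|_{U^k}$ is the unique nonnegative real $2^k$-th root of $$\|f\|_{U^k}^{2^k}=\frac{1}{N^{d(k+1)}}\sum_{x\in\mathbb{Z}_N^d}\ \sum_{h_1,\dots,h_k\in\mathbb{Z}_N^d}\ \prod_{w\in\{0,1\}^k}\mathrm{Conj}^{|w|}f(x+w\cdot h),$$ where $h=(h_1,\dots,h_k)$, $w\cdot h=\sum_{i=1}^k w_ih_i$, $|w|=\sum_i w_i$, and $\mathrm{Conj}^\ell$ denotes $\ell$-fold complex conjugation. *)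

theory Defs
  imports "HOL-Analysis.Analysis"
begin

text \<open>
  Elements of \<open>Z_N^d\<close> are represented by extensional functions on \<open>{..<d}\<close> whose
  values are the canonical representatives \<open>0, \<dots>, N - 1\<close>.  Since \<open>N\<close> and \<open>d\<close> are ordinary
  variables, a map \<open>Z_N^d \<rightarrow> \<complex>\<close> is a function of type \<open>(nat \<Rightarrow> int) \<Rightarrow> complex\<close> of which only
  the values on \<open>Zvec N d\<close> matter.
\<close>

definition Zvec :: "nat \<Rightarrow> nat \<Rightarrow> (nat \<Rightarrow> int) set" where
  "Zvec N d = ({..<d} \<rightarrow>\<^sub>E {0..<int N})"

definition supp :: "nat \<Rightarrow> nat \<Rightarrow> ((nat \<Rightarrow> int) \<Rightarrow> complex) \<Rightarrow> (nat \<Rightarrow> int) set" where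
  "supp N d f = {x \<in> Zvec N d. f x \<noteq> 0}"

text \<open>The character depends only on the residue of \<open>t\<close> modulo \<open>N\<close>, so it may be evaluated at
  integer representatives.\<close>

definition chi :: "nat \<Rightarrow> int \<Rightarrow> complex" where
  "chi N t = exp (2 * of_real pi * \<i> * of_int t / of_nat N)"

definition dft :: "nat \<Rightarrow> nat \<Rightarrow> ((nat \<Rightarrow> int) \<Rightarrow> complex) \<Rightarrow> (nat \<Rightarrow> int) \<Rightarrow> complex" where
  "dft N d f m = of_real (real N powr (- real d / 2)) *
     (\<Sum>x\<in>Zvec N d. f x * chi N (- (\<Sum>j<d. m j * x j)))"

text \<open>The point \<open>x + w \<cdot> h\<close> of \<open>Z_N^d\<close>; here \<open>h i\<close> is the \<open>i\<close>-th of the \<open>k\<close> direction vectors.\<close>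

definition cube_pt ::
  "nat \<Rightarrow> nat \<Rightarrow> nat \<Rightarrow> (nat \<Rightarrow> int) \<Rightarrow> (nat \<Rightarrow> nat \<Rightarrow> int) \<Rightarrow> (nat \<Rightarrow> nat) \<Rightarrow> nat \<Rightarrow> int" where
  "cube_pt N d k x h w = (\<lambda>j\<in>{..<d}. (x j + (\<Sum>i<k. int (w i) * h i j)) mod int N)"

definition gowers_avg :: "nat \<Rightarrow> nat \<Rightarrow> nat \<Rightarrow> ((nat \<Rightarrow> int) \<Rightarrow> complex) \<Rightarrow> complex" where
  "gowers_avg N d k f = 1 / of_nat (N ^ (d * (k + 1))) *
     (\<Sum>x\<in>Zvec N d. \<Sum>h\<in>{..<k} \<rightarrow>\<^sub>E Zvec N d. \<Prod>w\<in>{..<k} \<rightarrow>\<^sub>E {0, 1}.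
        (cnj ^^ (\<Sum>i<k. w i)) (f (cube_pt N d k x h w)))"

definition gowers_norm :: "nat \<Rightarrow> nat \<Rightarrow> nat \<Rightarrow> ((nat \<Rightarrow> int) \<Rightarrow> complex) \<Rightarrow> real" where
  "gowers_norm N d k f = (THE r. 0 \<le> r \<and> of_real (r ^ (2 ^ k)) = gowers_avg N d k f)"

text \<open>The element \<open>a\<close> of \<open>Z_N\<close>, for \<open>0 \<le> a < N\<close>, regarded as an element of \<open>Z_N^1\<close>.\<close>

definition pt :: "int \<Rightarrow> nat \<Rightarrow> int" where
  "pt a = (\<lambda>j\<in>{..<1}. a)"

end

theory Submission imports Defs "HOL-Real_Asymp.Real_Asymp" begin

text \<open>
  For \<open>a \<in> {1, 2}\<close>, a cube \<open>x + w \<cdot> h\<close> in \<open>Z_3\<close> based at \<open>x = a\<close> avoids \<open>0\<close> exactly when every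
  \<open>h i\<close> lies in \<open>{0, a}\<close> and at most one of them is \<open>a\<close>: an entry \<open>-a\<close> gives \<open>a - a = 0\<close>, and two
  entries \<open>a\<close> give \<open>3 a = 0\<close>.  Hence there are \<open>k + 1\<close> such cubes for each of the two values of
  \<open>a\<close>, and the \<open>2 ^ k\<close>-th power of the Gowers norm of \<open>1_{1,2}\<close> is \<open>2 (k + 1) / 3 ^ (k + 1)\<close>.
  The remaining claims concern \<open>n \<mapsto> (2 n) powr (1 / n)\<close>, which is decreasing because
  \<open>ln (2 n) / n\<close> is; the threshold comes from \<open>12 > (3/2) ^ 6\<close> and \<open>14 < (3/2) ^ 7\<close>.
\<close>

section \<open>Points and characters in dimension one\<close>

lemma pt_apply_0 [simp]: "pt a 0 = a"
  by (simp add: pt_def)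

lemma pt_eq_iff [simp]: "pt a = pt b \<longleftrightarrow> a = b"
  by (metis pt_apply_0)

text \<open>Vectors are extensional on \<open>{..<1}\<close>, so a one-dimensional one is determined
  by its entry at index 0.\<close>

lemma Zvec_1: "Zvec N 1 = pt ` {0..<int N}"
proof -
  have "x = pt (x 0)" if "x \<in> Zvec N 1" for x
  proof
    fix j
    show "x j = pt (x 0) j"
      using PiE_arb[of x "{..<1}" "\<lambda>_. {0..<int N}" j] that
      by (cases "j = 0") (simp_all add: Zvec_def pt_def)
  qed
  moreover have "x 0 \<in> {0..<int N}" if "x \<in> Zvec N 1" for x
    using PiE_mem[of x "{..<1}" "\<lambda>_. {0..<int N}" 0] that by (simp add: Zvec_def)
  moreover have "pt a \<in> Zvec N 1" if "a \<in> {0..<int N}" for a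
    using that by (simp add: Zvec_def pt_def)
  ultimately show ?thesis by (intro equalityI subsetI) (metis imageI, elim imageE, simp)
qed

lemma Zvec_3_1: "Zvec 3 1 = {pt 0, pt 1, pt 2}"
proof -
  have "{0..<int 3} = {0, 1, 2}" by auto
  then show ?thesis unfolding Zvec_1 by simp
qed

lemma finite_Zvec: "finite (Zvec N d)"
  by (auto simp: Zvec_def intro!: finite_PiE)

lemma chi_eq_1_iff:
  assumes "N > 0"
  shows "chi N t = 1 \<longleftrightarrow> int N dvd t"
proof -
  have "chi N t = 1 \<longleftrightarrow> (\<exists>n::int. 2 * pi * of_int t / real N = of_int (2 * n) * pi)"
    by (simp add: chi_def exp_eq_1)
  also have "\<dots> \<longleftrightarrow> (\<exists>n::int. real_of_int t = real_of_int (int N * n))"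
    using assms by (intro ex_cong1) (auto simp: field_simps)
  also have "\<dots> \<longleftrightarrow> int N dvd t"
    by (simp only: of_int_eq_iff dvd_def)
  finally show ?thesis .
qed

section \<open>The supports of the two-point function and of its transform\<close>

definition two_point :: "(nat \<Rightarrow> int) \<Rightarrow> complex" where
  "two_point x = indicator {pt 0} x - indicator {pt 1} x"

lemma supp_two_point: "supp 3 1 two_point = {pt 0, pt 1}"
  by (auto simp: supp_def Zvec_3_1[simplified] two_point_def indicator_def)

text \<open>Only the points 0 and 1 contribute, so the transform at \<open>m\<close> is a nonzero
  multiple of 1 - chi(-m), which vanishes exactly when 3 divides m.\<close>

lemma supp_dft_two_point: "supp 3 1 (dft 3 1 two_point) = {pt 1, pt 2}"
proof -
  have "dft 3 1 two_point m = of_real (3 powr (- 1 / 2)) * (1 - chi 3 (- m 0))" for m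
    by (simp add: dft_def Zvec_3_1[simplified] two_point_def chi_def)
  then have "dft 3 1 two_point m \<noteq> 0 \<longleftrightarrow> \<not> 3 dvd m 0" for m
    using chi_eq_1_iff[of 3 "- m 0"] by simp
  then have "supp 3 1 (dft 3 1 two_point) = {m \<in> {pt 0, pt 1, pt 2}. \<not> 3 dvd m 0}"
    by (simp only: supp_def Zvec_3_1)
  also have "\<dots> = {pt 1, pt 2}"
    by (intro set_eqI iffI; elim CollectE conjE insertE emptyE; simp)
  finally show ?thesis .
qed

section \<open>Counting the cubes that stay inside {1, 2}\<close>

definition cube_avoids_0 :: "nat \<Rightarrow> (nat \<Rightarrow> int) \<Rightarrow> (nat \<Rightarrow> nat \<Rightarrow> int) \<Rightarrow> bool" where
  "cube_avoids_0 k x h \<longleftrightarrow>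
     (\<forall>w\<in>{..<k} \<rightarrow>\<^sub>E {0, 1}. \<not> 3 dvd x 0 + (\<Sum>i<k. int (w i) * h i 0))"

text \<open>Divisibility by 3 does not see the reduction in \<open>cube_pt\<close>, so the count can
  use unreduced integer sums.\<close>

lemma cube_pt_in_iff:
  "cube_pt 3 1 k x h w \<in> {pt 1, pt 2} \<longleftrightarrow> \<not> 3 dvd x 0 + (\<Sum>i<k. int (w i) * h i 0)"
proof -
  have "cube_pt 3 1 k x h w = pt ((x 0 + (\<Sum>i<k. int (w i) * h i 0)) mod 3)"
    by (auto simp: cube_pt_def pt_def)
  then show ?thesis
    by (simp only: insert_iff empty_iff pt_eq_iff) presburger
qed

lemma funpow_cnj_indicator: "(cnj ^^ n) (indicator S x) = indicator S x"
  by (induction n) (auto simp: indicator_def)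

text \<open>Conjugation fixes 0 and 1, and a product of such factors is 1 only if all of them are;
  hence the sum counts the pairs \<open>(x, h)\<close> whose cube avoids 0.\<close>

lemma gowers_avg_indicator:
  "gowers_avg 3 1 k (indicator {pt 1, pt 2}) =
     of_nat (\<Sum>x\<in>Zvec 3 1. card {h \<in> {..<k} \<rightarrow>\<^sub>E Zvec 3 1. cube_avoids_0 k x h}) / 3 ^ (k + 1)"
proof -
  have prod: "(\<Prod>w\<in>{..<k} \<rightarrow>\<^sub>E {0, 1}. (cnj ^^ (\<Sum>i<k. w i))
      (indicator {pt 1, pt 2} (cube_pt 3 1 k x h w))) = of_bool (cube_avoids_0 k x h)" for x h
  proof -
    have fin: "finite ({..<k} \<rightarrow>\<^sub>E {0, 1::nat})"
      by (intro finite_PiE) auto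
    have "(\<Prod>w\<in>{..<k} \<rightarrow>\<^sub>E {0, 1}. (cnj ^^ (\<Sum>i<k. w i))
        (indicator {pt 1, pt 2} (cube_pt 3 1 k x h w))) =
      (\<Prod>w\<in>{..<k} \<rightarrow>\<^sub>E {0, 1}. of_bool (\<not> 3 dvd x 0 + (\<Sum>i<k. int (w i) * h i 0)) :: complex)"
      by (intro prod.cong refl)
        (simp only: funpow_cnj_indicator, simp only: indicator_def cube_pt_in_iff)
    also have "\<dots> = of_bool (cube_avoids_0 k x h)"
      using fin by (auto simp: cube_avoids_0_def)
    finally show ?thesis .
  qed
  have "finite ({..<k} \<rightarrow>\<^sub>E Zvec 3 1)"
    by (intro finite_PiE finite_Zvec finite_lessThan)
  then show ?thesis
    unfolding gowers_avg_def prod by (simp add: Int_def)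
qed

definition single_dir :: "nat \<Rightarrow> int \<Rightarrow> nat \<Rightarrow> nat \<Rightarrow> nat \<Rightarrow> int" where
  "single_dir k a j = (\<lambda>i\<in>{..<k}. pt (if i = j then a else 0))"

text \<open>The index \<open>j = k\<close> encodes the cube all of whose directions vanish.\<close>

lemma avoiding_directions_eq:
  assumes a: "a \<in> {1, 2}"
  shows "{h \<in> {..<k} \<rightarrow>\<^sub>E Zvec 3 1. cube_avoids_0 k (pt a) h} = single_dir k a ` {..k}"
proof (intro equalityI subsetI)
  fix h assume "h \<in> {h \<in> {..<k} \<rightarrow>\<^sub>E Zvec 3 1. cube_avoids_0 k (pt a) h}"
  then have h: "h \<in> {..<k} \<rightarrow>\<^sub>E {pt 0, pt 1, pt 2}"
    and good: "\<And>w. w \<in> {..<k} \<rightarrow>\<^sub>E {0, 1} \<Longrightarrow> \<not> 3 dvd a + (\<Sum>i<k. int (w i) * h i 0)"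
    by (auto simp: cube_avoids_0_def Zvec_3_1[simplified])
  \<comment> \<open>Taking for \<open>w\<close> the indicator of \<open>A\<close> turns avoidance
    into a condition on subset sums; singletons and pairs are enough below.\<close>
  have sub: "\<not> 3 dvd a + (\<Sum>i\<in>A. h i 0)" if "A \<subseteq> {..<k}" for A
  proof -
    let ?w = "\<lambda>i\<in>{..<k}. of_bool (i \<in> A) :: nat"
    have "(\<Sum>i<k. int (?w i) * h i 0) = (\<Sum>i\<in>A. h i 0)"
      using that by (intro sum.mono_neutral_cong_right) auto
    moreover have "?w \<in> {..<k} \<rightarrow>\<^sub>E {0, 1}"
      by auto
    ultimately show ?thesis using good[of ?w] by argo
  qed
  have val: "h i = pt 0 \<or> h i = pt a" if "i < k" for i
  proof -
    have "h i \<in> {pt 0, pt 1, pt 2}" using PiE_mem[OF h, of i] that by simp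
    moreover have "\<not> 3 dvd a + h i 0" using sub[of "{i}"] that by simp
    ultimately show ?thesis using a by auto
  qed
  have uniq: "i = j" if "i < k" "j < k" "h i = pt a" "h j = pt a" for i j
  proof (rule ccontr)
    assume "i \<noteq> j"
    then show False using sub[of "{i, j}"] that by simp
  qed
  show "h \<in> single_dir k a ` {..k}"
  proof (cases "\<exists>j<k. h j = pt a")
    case True
    then obtain j where j: "j < k" "h j = pt a" by (elim exE conjE)
    have "h i = single_dir k a j i" for i
    proof (cases "i < k")
      case True
      have "h i = (if i = j then pt a else pt 0)"
        using val[OF True] uniq[OF True j(1) _ j(2)] j(2) by metis
      then show ?thesis using True by (simp add: single_dir_def)
    next
      case False
      then show ?thesis using PiE_arb[OF h] by (simp add: single_dir_def)
    qed
    then have "h = single_dir k a j" by (rule ext)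
    then show ?thesis using j by simp
  next
    case no: False
    have "h i = single_dir k a k i" for i
    proof (cases "i < k")
      case True
      then have "h i = pt 0" using val[of i] no by blast
      then show ?thesis using True by (simp add: single_dir_def)
    next
      case False
      then show ?thesis using PiE_arb[OF h] by (simp add: single_dir_def)
    qed
    then have "h = single_dir k a k" by (rule ext)
    then show ?thesis by simp
  qed
next
  fix h assume "h \<in> single_dir k a ` {..k}"
  then obtain j where j: "j \<le> k" "h = single_dir k a j" by blast
  have "\<not> 3 dvd a + (\<Sum>i<k. int (w i) * h i 0)" if w: "w \<in> {..<k} \<rightarrow>\<^sub>E {0, 1}" for w
  proof -
    \<comment> \<open>At most the index \<open>j\<close> contributes, so each vertex is a or 2a, and
      3 divides neither. For \<open>j = k\<close> no index matches and the sum is 0.\<close>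
    have "(\<Sum>i<k. int (w i) * h i 0) = (\<Sum>i<k. if i = j then int (w j) * a else 0)"
      by (intro sum.cong) (auto simp: j single_dir_def)
    also have "\<dots> \<in> {0, a}"
      using w by (auto simp: PiE_def Pi_def)
    finally show ?thesis using a by auto
  qed
  moreover have "h \<in> {..<k} \<rightarrow>\<^sub>E Zvec 3 1"
    using a by (auto simp: j single_dir_def Zvec_3_1[simplified])
  ultimately show "h \<in> {h \<in> {..<k} \<rightarrow>\<^sub>E Zvec 3 1. cube_avoids_0 k (pt a) h}"
    by (auto simp: cube_avoids_0_def)
qed

text \<open>An index below \<open>k\<close> is recovered as the place where the direction is
  nonzero, and two distinct indices cannot both equal \<open>k\<close>.\<close>

lemma inj_on_single_dir:
  assumes "a \<noteq> 0"
  shows "inj_on (single_dir k a) {..k}"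
proof (rule inj_onI)
  fix i j assume ij: "i \<in> {..k}" "j \<in> {..k}" and eq: "single_dir k a i = single_dir k a j"
  have "i < k \<Longrightarrow> i = j" using fun_cong[OF eq, of i] assms
    by (auto simp: single_dir_def split: if_splits)
  moreover have "j < k \<Longrightarrow> i = j" using fun_cong[OF eq, of j] assms
    by (auto simp: single_dir_def split: if_splits)
  ultimately show "i = j" using ij by force
qed

lemma card_avoiding_directions:
  assumes "a \<in> {1, 2}"
  shows "card {h \<in> {..<k} \<rightarrow>\<^sub>E Zvec 3 1. cube_avoids_0 k (pt a) h} = k + 1"
proof -
  have "a \<noteq> 0" using assms by auto
  from card_image[OF inj_on_single_dir[OF this, of k]] show ?thesis
    unfolding avoiding_directions_eq[OF assms] by simp
qed

text \<open>The vertex with \<open>w = 0\<close> is the base point itself.\<close>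

lemma not_cube_avoids_0_pt_0: "\<not> cube_avoids_0 k (pt 0) h"
  unfolding cube_avoids_0_def by (simp, rule bexI[of _ "\<lambda>i\<in>{..<k}. 0"], auto)

lemma gowers_avg_eq:
  "gowers_avg 3 1 k (indicator {pt 1, pt 2}) = of_real (2 * real (k + 1) / 3 ^ (k + 1))"
proof -
  have "(\<Sum>x\<in>Zvec 3 1. card {h \<in> {..<k} \<rightarrow>\<^sub>E Zvec 3 1. cube_avoids_0 k x h}) = 2 * (k + 1)"
    unfolding Zvec_3_1
    using card_avoiding_directions[of 1 k] card_avoiding_directions[of 2 k]
    by (simp add: not_cube_avoids_0_pt_0 Zvec_3_1[simplified])
  then show ?thesis
    unfolding gowers_avg_indicator by simp
qed

section \<open>From the Gowers average to the norm and its closed form\<close>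

lemma gowers_norm_power:
  assumes "gowers_avg N d k f = of_real c" "0 \<le> c"
  shows "0 \<le> gowers_norm N d k f \<and> gowers_norm N d k f ^ (2 ^ k) = c"
proof -
  \<comment> \<open>The norm is a definite description, so its properties become available only once
    the nonnegative root is known to exist and be unique.\<close>
  have "\<exists>!r. 0 \<le> r \<and> of_real (r ^ (2 ^ k)) = gowers_avg N d k f"
  proof (intro ex1I conjI)
    show "0 \<le> root (2 ^ k) c" using assms by simp
    show "of_real (root (2 ^ k) c ^ (2 ^ k)) = gowers_avg N d k f" using assms by simp
    fix r :: real
    assume r: "0 \<le> r \<and> of_real (r ^ (2 ^ k)) = gowers_avg N d k f"
    then have "r ^ (2 ^ k) = c" using assms by (simp only: of_real_eq_iff)
    then show "r = root (2 ^ k) c" using r by (metis real_root_pos_unique zero_less_numeral zero_less_power)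
  qed
  from theI'[OF this] have
    "0 \<le> gowers_norm N d k f \<and> of_real (gowers_norm N d k f ^ (2 ^ k)) = gowers_avg N d k f"
    unfolding gowers_norm_def .
  then show ?thesis
    unfolding assms(1) of_real_eq_iff .
qed

definition uncertainty_value :: "nat \<Rightarrow> real" where
  "uncertainty_value k = 2 / 3 * (2 * real (k + 1)) powr (1 / real (k + 1))"

text \<open>The exponent amounts to a (k+1)-th root of the average, which turns the normalisation
  3^(k+1) into 3. The leading 2 is the size of E.\<close>

lemma gowers_norm_powr:
  "2 * gowers_norm 3 1 k (indicator {pt 1, pt 2}) powr (2 ^ k / real (k + 1)) = uncertainty_value k"
proof -
  let ?r = "gowers_norm 3 1 k (indicator {pt 1, pt 2})"
  have r: "0 \<le> ?r" "?r ^ (2 ^ k) = 2 * real (k + 1) / 3 ^ (k + 1)"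
    using gowers_norm_power[OF gowers_avg_eq, of k] by auto
  \<comment> \<open>Rewriting natural powers as \<open>powr\<close> requires a strictly positive
    base.\<close>
  have "0 < ?r ^ (2 ^ k)"
    unfolding r(2) by simp
  then have "?r \<noteq> 0"
    by (metis less_irrefl power_eq_0_iff zero_less_numeral zero_less_power)
  with r(1) have "?r > 0"
    by linarith
  then have "?r powr (2 ^ k / real (k + 1)) = (?r ^ (2 ^ k)) powr (1 / real (k + 1))"
    by (simp add: powr_realpow[symmetric] powr_powr)
  also have "\<dots> = (2 * real (k + 1)) powr (1 / real (k + 1)) / (3 ^ (k + 1)) powr (1 / real (k + 1))"
    unfolding r(2) by (subst powr_divide) auto
  also have "(3 ^ (k + 1)) powr (1 / real (k + 1)) = (3 :: real)"
    by (simp add: powr_realpow[symmetric] powr_powr del: power_Suc)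
  finally show ?thesis by (simp add: uncertainty_value_def)
qed

section \<open>Threshold, monotonicity and limit of the closed form\<close>

lemma uncertainty_value_less_1_iff:
  "uncertainty_value k < 1 \<longleftrightarrow> 2 * real (k + 1) < (3 / 2) ^ (k + 1)"
proof -
  have "uncertainty_value k < 1 \<longleftrightarrow> (2 * real (k + 1)) powr (1 / real (k + 1)) < 3 / 2"
    by (auto simp: uncertainty_value_def)
  \<comment> \<open>With 3/2 written as a (k+1)-th root, strict monotonicity of \<open>powr\<close>
    removes the exponent from both sides.\<close>
  also have "(3 / 2 :: real) = ((3 / 2) ^ (k + 1)) powr (1 / real (k + 1))"
    by (simp add: powr_realpow[symmetric] powr_powr del: power_Suc)
  also have "(2 * real (k + 1)) powr (1 / real (k + 1)) < \<dots> \<longleftrightarrow>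
      2 * real (k + 1) < (3 / 2) ^ (k + 1)"
    using powr_less_cancel2[of "1 / real (k + 1)" "2 * real (k + 1)" "(3 / 2) ^ (k + 1)"]
      powr_less_mono2[of "1 / real (k + 1)" "2 * real (k + 1)" "(3 / 2) ^ (k + 1)"]
    by (intro iffI) simp_all
  finally show ?thesis .
qed

lemma linear_less_power_iff:
  assumes "k \<ge> 2"
  shows "2 * real (k + 1) < (3 / 2) ^ (k + 1) \<longleftrightarrow> k \<ge> 6"
proof (cases "k \<ge> 6")
  case True
  then have "2 * real (k + 1) < (3 / 2) ^ (k + 1)"
  proof (induction k rule: dec_induct)
    case base
    then show ?case by (simp add: power_divide)
  next
    case (step n)
    \<comment> \<open>The power gains a factor 3/2, which suffices because 3(n+1) >= 2(n+2) for n >=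
      1.\<close>
    have "(3 / 2 :: real) ^ (Suc n + 1) = 3 / 2 * (3 / 2) ^ (n + 1)" by simp
    then show ?case using step by simp
  qed
  with True show ?thesis by simp
next
  case False
  then have "k = 2 \<or> k = 3 \<or> k = 4 \<or> k = 5" using assms by auto
  then show ?thesis by (auto simp: power_divide)
qed

text \<open>After taking logarithms, the point is that ln(2x)/x has derivative (1 - ln(2x))/x^2,
  negative once 2x > e. The bound \<open>2 \<le> j\<close> gives x >= 3, hence 2x >= 6.\<close>

lemma uncertainty_value_strict_antimono:
  assumes "2 \<le> j" "j < k"
  shows "uncertainty_value k < uncertainty_value j"
proof -
  have "ln (2 * real (k + 1)) / real (k + 1) < ln (2 * real (j + 1)) / real (j + 1)"
  proof (rule DERIV_neg_imp_decreasing[where f = "\<lambda>x. ln (2 * x) / x"])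
    show "real (j + 1) < real (k + 1)" using assms by simp
    fix x :: real assume x: "real (j + 1) \<le> x" "x \<le> real (k + 1)"
    then have "x \<ge> 3" using assms by linarith
    have "1 < ln (2 * x)"
    proof -
      have "exp 1 < 2 * x" using exp_le \<open>x \<ge> 3\<close> by linarith
      then show ?thesis using ln_less_cancel_iff[of "exp 1" "2 * x"] \<open>x \<ge> 3\<close> by simp
    qed
    moreover have "((\<lambda>x. ln (2 * x) / x) has_real_derivative (1 - ln (2 * x)) / x ^ 2) (at x)"
      using \<open>x \<ge> 3\<close> by (auto intro!: derivative_eq_intros simp: field_simps power2_eq_square)
    ultimately show "\<exists>y. ((\<lambda>x. ln (2 * x) / x) has_real_derivative y) (at x) \<and> y < 0"
      using \<open>x \<ge> 3\<close> by (intro exI[of _ "(1 - ln (2 * x)) / x ^ 2"]) (auto simp: divide_neg_pos)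
  qed
  then show ?thesis
    by (simp add: uncertainty_value_def powr_def)
qed

lemma uncertainty_value_tendsto: "uncertainty_value \<longlonglongrightarrow> 2 / 3"
  unfolding uncertainty_value_def by real_asymp

theorem theorem1p3:
  fixes f :: "(nat \<Rightarrow> int) \<Rightarrow> complex"
    and E \<Sigma> :: "(nat \<Rightarrow> int) set"
    and Q :: "nat \<Rightarrow> real"
  assumes f: "f = (\<lambda>x. indicator {pt 0} x - indicator {pt 1} x)"
    and E: "E = supp 3 1 f"
    and S: "\<Sigma> = supp 3 1 (dft 3 1 f)"
    and Q: "Q = (\<lambda>k. real (card E) *
                  gowers_norm 3 1 k (indicator \<Sigma>) powr (2 ^ k / real (k + 1)))"
  shows "E = {pt 0, pt 1} \<and> \<Sigma> = {pt 1, pt 2} \<and>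
    (\<forall>k\<ge>2. Q k = 2 / 3 * (2 * real (k + 1)) powr (1 / real (k + 1))) \<and>
    (\<forall>k\<ge>2. Q k < 1 \<longleftrightarrow> k \<ge> 6) \<and>
    (\<forall>j k. 2 \<le> j \<longrightarrow> j < k \<longrightarrow> Q k < Q j) \<and>
    Q \<longlonglongrightarrow> 2 / 3 \<and>
    (\<forall>k\<ge>6. \<not> (\<forall>N\<ge>2. \<forall>d\<ge>1. \<forall>g :: (nat \<Rightarrow> int) \<Rightarrow> complex.
        (\<exists>x\<in>Zvec N d. g x \<noteq> 0) \<longrightarrow>
        1 \<le> real (card (supp N d g)) *
            gowers_norm N d k (indicator (supp N d (dft N d g))) powr (2 ^ k / real (k + 1))))"
proof -
  have f_eq: "f = two_point"
    by (auto simp: f two_point_def)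
  have E_eq: "E = {pt 0, pt 1}" and S_eq: "\<Sigma> = {pt 1, pt 2}"
    by (simp_all only: E S f_eq supp_two_point supp_dft_two_point)
  have card_E: "card E = 2"
    by (simp add: E_eq)
  have Q_eq: "Q = uncertainty_value"
    using gowers_norm_powr by (simp add: Q card_E S_eq)
  have less_1: "Q k < 1 \<longleftrightarrow> k \<ge> 6" if "k \<ge> 2" for k
    using that by (simp only: Q_eq uncertainty_value_less_1_iff linear_less_power_iff)
  have "\<not> (\<forall>N\<ge>2. \<forall>d\<ge>1. \<forall>g :: (nat \<Rightarrow> int) \<Rightarrow> complex.
        (\<exists>x\<in>Zvec N d. g x \<noteq> 0) \<longrightarrow>
        1 \<le> real (card (supp N d g)) *
            gowers_norm N d k (indicator (supp N d (dft N d g))) powr (2 ^ k / real (k + 1)))"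
    (is "\<not> ?claim") if "k \<ge> 6" for k
  proof
    assume ?claim
    \<comment> \<open>The counterexample is \<open>f\<close> itself; it is nonzero because E is
      nonempty.\<close>
    from this[rule_format, of 3 1 f] have "1 \<le> Q k"
      using E E_eq by (auto simp: supp_def Q S)
    then show False using less_1[of k] that by simp
  qed
  moreover have "Q k = 2 / 3 * (2 * real (k + 1)) powr (1 / real (k + 1))" for k
    by (simp only: Q_eq uncertainty_value_def)
  moreover have "Q k < Q j" if "2 \<le> j" "j < k" for j k
    using uncertainty_value_strict_antimono[OF that] by (simp only: Q_eq)
  moreover have "Q \<longlonglongrightarrow> 2 / 3"
    using uncertainty_value_tendsto by (simp only: Q_eq)
  ultimately show ?thesis
    using E_eq S_eq less_1 by (intro conjI allI impI) blast+
qed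

end
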